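(* If $G$ and $H$ are non-trivial generalized complete graphs, then $$\mu_{\rm t}(G\,\square\,H)\le \mu_{\rm t}(G)\,\mu_{\rm t}(H)=(n(G)-1)(n(H)-1).$$ Moreover, equality $\mu_{\rm t}(G\,\square\,H)=(n(G)-1)(n(H)-1)$ holds if and only if $G$ or $H$ is isomorphic to a star.
   Context: A generalized complete graph is the join of a single vertex with a disjoint union of $k\ge 1$ complete graphs; it is non-trivial if $k\ge 2$. A star is a graph $K_{1,r}$. $n(G)$ is the order of $G$. The Cartesian product $G\,\square\,H$ has vertex set $V(G)\times V(H)$, with $(g,h)$ adjacent to $(g',h')$ iff either $gg'\in E(G)$ and $h=h'$, or $g=g'$ and $hh'\in E(H)$. For a connected graph $G$ and $X\subseteq V(G)$, two vertices $x,y$ are $X$-visible if there is a shortest $x,y$-path $P$ with $V(P)\cap X\subseteq\{x,y\}$; $X$ is a total mutual-visibility set if every pair of vertices of $G$ is $X$-visible. $\mu_{\rm t}(G)$ is the largest cardinality of a total mutual-visibility set of $G$. *)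

theory Defs
  imports "Graph_Theory.Graph_Theory" "HOL-Library.Disjoint_Sets"
begin

text \<open>
  Finite simple graphs are \<^const>\<open>pair_graph\<close>s: finite, loop-free, symmetric digraphs without
  parallel arcs, in which an edge \<open>uv\<close> is the pair of arcs \<open>(u,v)\<close>, \<open>(v,u)\<close>.
\<close>

section \<open>Graph constructions\<close>

definition single_vertex :: "'a \<Rightarrow> 'a pair_pre_digraph" where
  "single_vertex c = \<lparr> pverts = {c}, parcs = {} \<rparr>"

text \<open>The next two operations are used on vertex-disjoint graphs only.\<close>

definition graph_Union :: "'i set \<Rightarrow> ('i \<Rightarrow> 'a pair_pre_digraph) \<Rightarrow> 'a pair_pre_digraph" where
  "graph_Union I Q = \<lparr> pverts = (\<Union>i\<in>I. pverts (Q i)), parcs = (\<Union>i\<in>I. parcs (Q i)) \<rparr>"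

definition graph_join :: "'a pair_pre_digraph \<Rightarrow> 'a pair_pre_digraph \<Rightarrow> 'a pair_pre_digraph" where
  "graph_join G H = \<lparr> pverts = pverts G \<union> pverts H,
     parcs = parcs G \<union> parcs H \<union> pverts G \<times> pverts H \<union> pverts H \<times> pverts G \<rparr>"

definition cartesian_product ::
  "'a pair_pre_digraph \<Rightarrow> 'b pair_pre_digraph \<Rightarrow> ('a \<times> 'b) pair_pre_digraph" (infixl \<open>\<box>\<close> 70) where
  "G \<box> H = \<lparr> pverts = pverts G \<times> pverts H,
     parcs = {((g,h),(g',h')). (g,h) \<in> pverts G \<times> pverts H \<and> (g',h') \<in> pverts G \<times> pverts H \<and>
       ((g,g') \<in> parcs G \<and> h = h' \<or> g = g' \<and> (h,h') \<in> parcs H)} \<rparr>"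

section \<open>Generalized complete graphs and stars\<close>

text \<open>
  \<open>K\<^bsub>n\<^esub>\<close> is the library's predicate that a graph is complete of order \<open>n\<close>. The complete
  graphs are non-null (\<open>n \<ge> 1\<close>), as otherwise \<open>k\<close> would not count the cliques. The parts are
  taken inside \<open>G\<close>, so the predicate is closed under isomorphism.
\<close>

definition generalized_complete_graph :: "nat \<Rightarrow> 'a pair_pre_digraph \<Rightarrow> bool" where
  "generalized_complete_graph k G \<longleftrightarrow> k \<ge> 1 \<and>
     (\<exists>c Q. (\<forall>i<k. \<exists>n\<ge>1. K\<^bsub>n\<^esub> (with_proj (Q i)))
        \<and> disjoint_family_on (\<lambda>i. pverts (Q i)) {..<k}
        \<and> (\<forall>i<k. c \<notin> pverts (Q i))
        \<and> G = graph_join (single_vertex c) (graph_Union {..<k} Q))"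

lemma pair_graph_generalized_complete_graph:
  assumes "generalized_complete_graph k G"
  shows "pair_graph G"
proof -
  from assms obtain c Q where
    K: "\<And>i. i < k \<Longrightarrow> \<exists>n\<ge>1. K\<^bsub>n\<^esub> (with_proj (Q i))" and
    c: "\<And>i. i < k \<Longrightarrow> c \<notin> pverts (Q i)" and
    G: "G = graph_join (single_vertex c) (graph_Union {..<k} Q)"
    unfolding generalized_complete_graph_def by blast
  have fin: "finite (pverts (Q i))"
    and arcs: "parcs (Q i) = {(u,v). (u,v) \<in> pverts (Q i) \<times> pverts (Q i) \<and> u \<noteq> v}"
    if "i < k" for i
    using K[OF that] by (auto simp: complete_digraph_pair_def)
  have sub: "parcs G \<subseteq> pverts G \<times> pverts G"
    unfolding G graph_join_def single_vertex_def graph_Union_def using arcs by auto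
  have finV: "finite (pverts G)"
    unfolding G graph_join_def single_vertex_def graph_Union_def using fin by auto
  have irr: "u \<noteq> v" if "(u,v) \<in> parcs G" for u v
    using that c arcs unfolding G graph_join_def single_vertex_def graph_Union_def by auto
  have sym: "(v,u) \<in> parcs G" if "(u,v) \<in> parcs G" for u v
    using that arcs unfolding G graph_join_def single_vertex_def graph_Union_def by auto
  have "finite (parcs G)" using finite_subset[OF sub] finV by blast
  with sub finV irr sym show ?thesis
    by unfold_locales (auto simp: symmetric_def intro!: symI)
qed

definition nontrivial_generalized_complete_graph :: "'a pair_pre_digraph \<Rightarrow> bool" where
  "nontrivial_generalized_complete_graph G \<longleftrightarrow> (\<exists>k\<ge>2. generalized_complete_graph k G)"

text \<open>The library's \<open>K\<^bsub>m,n\<^esub>\<close> is a predicate on graphs, so isomorphism is built in.\<close>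

definition star :: "'a pair_pre_digraph \<Rightarrow> bool" where
  "star G \<longleftrightarrow> (\<exists>r. K\<^bsub>1,r\<^esub> (with_proj G))"

section \<open>Total mutual-visibility\<close>

text \<open>A path is given by its list of vertices.\<close>

definition shortest_path :: "'a pair_pre_digraph \<Rightarrow> 'a \<Rightarrow> 'a list \<Rightarrow> 'a \<Rightarrow> bool" where
  "shortest_path G x p y \<longleftrightarrow> vpath p (with_proj G) \<and> hd p = x \<and> last p = y \<and>
     (\<forall>q. vpath q (with_proj G) \<and> hd q = x \<and> last q = y \<longrightarrow> vwalk_length p \<le> vwalk_length q)"

definition visible :: "'a pair_pre_digraph \<Rightarrow> 'a set \<Rightarrow> 'a \<Rightarrow> 'a \<Rightarrow> bool" where
  "visible G X x y \<longleftrightarrow> (\<exists>p. shortest_path G x p y \<and> set p \<inter> X \<subseteq> {x, y})"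

definition total_mutual_visibility_set :: "'a pair_pre_digraph \<Rightarrow> 'a set \<Rightarrow> bool" where
  "total_mutual_visibility_set G X \<longleftrightarrow>
     X \<subseteq> pverts G \<and> (\<forall>x\<in>pverts G. \<forall>y\<in>pverts G. visible G X x y)"

text \<open>
  For a finite connected graph the maximum is over a finite nonempty set, since the empty set is a
  total mutual-visibility set.
\<close>

definition mu_t :: "'a pair_pre_digraph \<Rightarrow> nat" where
  "mu_t G = Max {card X | X. total_mutual_visibility_set G X}"

end

theory Submission
  imports Defs
begin

text \<open>
  Let \<open>c\<close> and \<open>d\<close> be the universal vertices of \<open>G\<close> and \<open>H\<close>. Two vertices of different cliques of
  \<open>G\<close> have \<open>c\<close> as their only common neighbour, so a total mutual-visibility set of \<open>G\<close> avoids
  \<open>c\<close>, and one of \<open>G \<box> H\<close> avoids the layers through \<open>c\<close> and \<open>d\<close>; hence it lies in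
  \<open>(V(G) - {c}) \<times> (V(H) - {d})\<close>. That whole set works if \<open>G\<close> is a star, since every pair of vertices
  in different \<open>H\<close>-layers is joined by a shortest path running through the layer of \<open>c\<close>. If neither
  factor is a star, an edge of \<open>G - c\<close> and an edge of \<open>H - d\<close> span a 4-cycle inside the set, whose
  opposite corners do not see each other.
\<close>

section \<open>Walks and visibility\<close>

text \<open>Walks rather than paths, with \<open>n\<close> only an upper bound and \<open>S\<close>
  only a superset of the visited vertices, so that pieces can be concatenated freely. The list of a
  walk with \<open>n\<close> edges has \<open>Suc n\<close> entries.\<close>

definition walk_in :: "'a pair_pre_digraph \<Rightarrow> 'a set \<Rightarrow> nat \<Rightarrow> 'a \<Rightarrow> 'a \<Rightarrow> bool" where
  "walk_in G S n x y \<longleftrightarrow>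
     (\<exists>p. vwalk p (with_proj G) \<and> hd p = x \<and> last p = y \<and> length p \<le> Suc n \<and> set p \<subseteq> S)"

lemma walk_in_trans:
  assumes "walk_in G S m x y" "walk_in G T n y z"
  shows "walk_in G (S \<union> T) (m + n) x z"
proof -
  obtain p where p: "vwalk p (with_proj G)" "hd p = x" "last p = y" "length p \<le> Suc m" "set p \<subseteq> S"
    using assms(1) unfolding walk_in_def by blast
  obtain q where q: "vwalk q (with_proj G)" "hd q = y" "last q = z" "length q \<le> Suc n" "set q \<subseteq> T"
    using assms(2) unfolding walk_in_def by blast
  have ne: "p \<noteq> []" "q \<noteq> []"
    using p(1) q(1) by auto
  then have "joinable p q"
    using p(3) q(2) by auto
  then have "vwalk (p \<oplus> q) (with_proj G)" "hd (p \<oplus> q) = x" "last (p \<oplus> q) = z"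
    using p q vwalk_joinI_vwalk vwalk_join_hd vwalk_join_last by blast+
  moreover have "set (p \<oplus> q) \<subseteq> S \<union> T" "length (p \<oplus> q) \<le> Suc (m + n)"
    using p(4,5) q(4,5) ne by (auto simp: vwalk_join_def dest: list.set_sel(2))
  ultimately show ?thesis
    unfolding walk_in_def by blast
qed

lemma length_vwalk_to_vpath_le:
  assumes "vwalk p G"
  shows "length (vwalk_to_vpath p) \<le> length p"
proof -
  have "length (vwalk_to_vpath p) = card (set (vwalk_to_vpath p))"
    using vwalk_to_vpath_vpath[OF assms] by (auto simp: distinct_card)
  also have "\<dots> \<le> card (set p)"
    by (intro card_mono) (auto dest: vwalk_to_vpath_subset)
  also have "\<dots> \<le> length p"
    by (rule card_length)
  finally show ?thesis .
qed

text \<open>Shortcutting the walk gives a path that stays in \<open>S\<close> and has length at most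
  \<open>n\<close>. As \<open>n\<close> bounds all walks from \<open>x\<close> to \<open>y\<close>
  from below, this path is shortest.\<close>

lemma visibleI:
  assumes "walk_in G S n x y"
    and "\<And>q. vwalk q (with_proj G) \<Longrightarrow> hd q = x \<Longrightarrow> last q = y \<Longrightarrow> n \<le> vwalk_length q"
    and "S \<inter> X \<subseteq> {x, y}"
  shows "visible G X x y"
proof -
  obtain p where p: "vwalk p (with_proj G)" "hd p = x" "last p = y" "length p \<le> Suc n" "set p \<subseteq> S"
    using assms(1) unfolding walk_in_def by blast
  let ?q = "vwalk_to_vpath p"
  have "vpath ?q (with_proj G)" "hd ?q = x" "last ?q = y" "set ?q \<subseteq> S"
    using p by (auto simp: vwalk_to_vpath_vpath vwalk_to_vpath_hd vwalk_to_vpath_last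
        dest: vwalk_to_vpath_subset)
  moreover have "vwalk_length ?q \<le> n"
    using length_vwalk_to_vpath_le[OF p(1)] p(4) by simp
  ultimately have "shortest_path G x ?q y"
    unfolding shortest_path_def using assms(2) by (meson order_trans vpathE)
  then show ?thesis
    unfolding visible_def using assms(3) \<open>set ?q \<subseteq> S\<close> by blast
qed

text \<open>The vertex \<open>w\<close> bounds the distance by 2, and distinct nonadjacent vertices
  are no closer. So the shortest path witnessing visibility is \<open>[x, z, y]\<close>, and its
  inner vertex \<open>z\<close> must avoid \<open>X\<close>.\<close>

lemma visible_common_neighbour:
  assumes "visible G X x y" "x \<noteq> y" "(x, y) \<notin> parcs G"
    and "(x, w) \<in> parcs G" "(w, y) \<in> parcs G"
    and wf: "\<And>u v. (u, v) \<in> parcs G \<Longrightarrow> u \<in> pverts G \<and> v \<in> pverts G \<and> u \<noteq> v"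
  obtains z where "(x, z) \<in> parcs G" "(z, y) \<in> parcs G" "z \<notin> X"
proof -
  obtain p where p: "vpath p (with_proj G)" "hd p = x" "last p = y" "set p \<inter> X \<subseteq> {x, y}"
    and min: "\<And>q. vpath q (with_proj G) \<Longrightarrow> hd q = x \<Longrightarrow> last q = y \<Longrightarrow>
      vwalk_length p \<le> vwalk_length q"
    using assms(1) unfolding visible_def shortest_path_def by blast
  have "vpath [x, w, y] (with_proj G)"
    using assms wf by (auto simp: vpath_def vwalk_def)
  from min[OF this] have "length p \<le> 3"
    by simp
  moreover have "p \<noteq> []" "set (vwalk_arcs p) \<subseteq> parcs G"
    using p(1) by (auto simp: vpath_def vwalk_def)
  ultimately obtain z where "p = [x, z, y]"
    using p(2,3) assms(2,3)
    by (cases p rule: vwalk_arcs.cases; cases "tl (tl p)"; cases "tl (tl (tl p))") auto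
  then show ?thesis
    using that[of z] p \<open>set (vwalk_arcs p) \<subseteq> parcs G\<close> wf by fastforce
qed

section \<open>Distances in Cartesian products\<close>

text \<open>The distance if the diameter is at most 2, and a lower bound for it in general.\<close>

definition dist2 :: "'a pair_pre_digraph \<Rightarrow> 'a \<Rightarrow> 'a \<Rightarrow> nat" where
  "dist2 G u v = (if u = v then 0 else if (u, v) \<in> parcs G then 1 else 2)"

text \<open>If \<open>v = w\<close>, the arc itself gives the bound. Otherwise the right-hand side
  is at least 2, the largest value of \<open>dist2\<close>.\<close>

lemma dist2_arc: "(u, v) \<in> parcs G \<Longrightarrow> dist2 G u w \<le> Suc (dist2 G v w)"
  by (auto simp: dist2_def)

lemma dist2_le_vwalk_length:
  assumes "vwalk p (with_proj G)"
  shows "dist2 G (hd p) (last p) \<le> vwalk_length p"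
  using assms
proof (induction p rule: vwalk_induct)
  case (Cons u v es)
  then show ?case using dist2_arc[of u v G "last (v # es)"] by simp
qed (simp add: dist2_def)

text \<open>Each arc of the product moves in one coordinate and fixes the other, so prepending it
  raises the sum of the two \<open>dist2\<close> terms by at most one.\<close>

lemma product_dist_le_vwalk_length:
  assumes "vwalk p (with_proj (G \<box> H))"
  shows "dist2 G (fst (hd p)) (fst (last p)) + dist2 H (snd (hd p)) (snd (last p)) \<le> vwalk_length p"
  using assms
proof (induction p rule: vwalk_induct)
  case (Cons u v es)
  have "fst u = fst v \<and> (snd u, snd v) \<in> parcs H \<or> snd u = snd v \<and> (fst u, fst v) \<in> parcs G"
    using Cons(1) by (auto simp: cartesian_product_def)
  then show ?case
    using Cons(2) dist2_arc[of "fst u" "fst v" G "fst (last (v # es))"]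
      dist2_arc[of "snd u" "snd v" H "snd (last (v # es))"] by auto
qed (simp add: dist2_def)

lemma pverts_product [simp]: "pverts (G \<box> H) = pverts G \<times> pverts H"
  by (simp add: cartesian_product_def)

section \<open>Embedding walks into layers of a product\<close>

lemma vwalk_arcs_map: "vwalk_arcs (map f p) = map (map_prod f f) (vwalk_arcs p)"
  by (induction p rule: vwalk_arcs.induct) auto

lemma vwalk_map:
  assumes "vwalk p (with_proj G)"
    and "\<And>u. u \<in> pverts G \<Longrightarrow> f u \<in> pverts G'"
    and "\<And>u v. (u, v) \<in> parcs G \<Longrightarrow> u \<in> pverts G \<Longrightarrow> v \<in> pverts G \<Longrightarrow> (f u, f v) \<in> parcs G'"
  shows "vwalk (map f p) (with_proj G')"
proof -
  have "(u, v) \<in> parcs G \<and> u \<in> pverts G \<and> v \<in> pverts G" if "(u, v) \<in> set (vwalk_arcs p)" for u v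
    using assms(1) arcs_in_vwalk_arcs[OF that] that by (auto simp: vwalk_def)
  then show ?thesis
    using assms by (auto simp: vwalk_def vwalk_arcs_map)
qed

lemma walk_in_map:
  assumes "walk_in G S n x y"
    and "\<And>u. u \<in> pverts G \<Longrightarrow> f u \<in> pverts G'"
    and "\<And>u v. (u, v) \<in> parcs G \<Longrightarrow> u \<in> pverts G \<Longrightarrow> v \<in> pverts G \<Longrightarrow> (f u, f v) \<in> parcs G'"
  shows "walk_in G' (f ` S) n (f x) (f y)"
proof -
  obtain p where p: "vwalk p (with_proj G)" "hd p = x" "last p = y" "length p \<le> Suc n" "set p \<subseteq> S"
    using assms(1) unfolding walk_in_def by blast
  have "vwalk (map f p) (with_proj G')"
    using vwalk_map[OF p(1)] assms by blast
  moreover have "p \<noteq> []" using p(1) by auto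
  ultimately show ?thesis
    using p unfolding walk_in_def
    by (intro exI[of _ "map f p"]) (auto simp: hd_map last_map)
qed

lemma walk_in_product_left:
  assumes "walk_in G S n x y" "h \<in> pverts H"
  shows "walk_in (G \<box> H) (S \<times> {h}) n (x, h) (y, h)"
proof -
  have "(\<lambda>g. (g, h)) ` S = S \<times> {h}" by auto
  with walk_in_map[OF assms(1), where f = "\<lambda>g. (g, h)" and G' = "G \<box> H"] show ?thesis
    using assms(2) by (simp add: cartesian_product_def)
qed

lemma walk_in_product_right:
  assumes "walk_in H S n x y" "g \<in> pverts G"
  shows "walk_in (G \<box> H) ({g} \<times> S) n (g, x) (g, y)"
proof -
  have "Pair g ` S = {g} \<times> S" by auto
  with walk_in_map[OF assms(1), where f = "Pair g" and G' = "G \<box> H"] show ?thesis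
    using assms(2) by (simp add: cartesian_product_def)
qed

text \<open>A walk whose length attains the lower bound for the product is automatically
  shortest.\<close>

lemma visible_productI:
  assumes "walk_in (G \<box> H) S (dist2 G g g' + dist2 H h h') (g, h) (g', h')"
    and "S \<inter> X \<subseteq> {(g, h), (g', h')}"
  shows "visible (G \<box> H) X (g, h) (g', h')"
proof (rule visibleI[OF assms(1) _ assms(2)])
  show "dist2 G g g' + dist2 H h h' \<le> vwalk_length q"
    if "vwalk q (with_proj (G \<box> H))" "hd q = (g, h)" "last q = (g', h')" for q
    using product_dist_le_vwalk_length[OF that(1)] that(2,3) by simp
qed

section \<open>Exchanging the two factors\<close>

lemma vwalk_swap:
  assumes "vwalk p (with_proj (G \<box> H))"
  shows "vwalk (map prod.swap p) (with_proj (H \<box> G))"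
  using assms by (rule vwalk_map) (auto simp: cartesian_product_def)

lemma shortest_path_swap:
  assumes "shortest_path (G \<box> H) x p y"
  shows "shortest_path (H \<box> G) (prod.swap x) (map prod.swap p) (prod.swap y)"
proof -
  have p: "vwalk p (with_proj (G \<box> H))" "distinct p" "hd p = x" "last p = y" "p \<noteq> []"
    using assms unfolding shortest_path_def vpath_def by auto
  have "vwalk_length p \<le> vwalk_length q"
    if q: "vpath q (with_proj (H \<box> G))" "hd q = prod.swap x" "last q = prod.swap y" for q
  proof -
    have "q \<noteq> []" using q(1) by auto
    \<comment> \<open>A competitor \<open>q\<close> is carried back to \<open>G \<box> H\<close>,
      where \<open>p\<close> is known to be shortest; swapping preserves length.\<close>
    then have "vpath (map prod.swap q) (with_proj (G \<box> H))" "hd (map prod.swap q) = x"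
      "last (map prod.swap q) = y"
      using q vwalk_swap[of q H G] by (auto simp: vpath_def distinct_map hd_map last_map)
    then have "vwalk_length p \<le> vwalk_length (map prod.swap q)"
      using assms unfolding shortest_path_def by blast
    then show ?thesis by simp
  qed
  then show ?thesis
    using p vwalk_swap[OF p(1)] unfolding shortest_path_def
    by (auto simp: vpath_def distinct_map hd_map last_map)
qed

text \<open>Lets the apex-layer obstruction and the star construction be proved for the first factor
  only.\<close>

lemma total_mutual_visibility_set_swap:
  assumes "total_mutual_visibility_set (G \<box> H) X"
  shows "total_mutual_visibility_set (H \<box> G) (prod.swap ` X)"
proof -
  have "visible (H \<box> G) (prod.swap ` X) x y"
    if xy: "x \<in> pverts (H \<box> G)" "y \<in> pverts (H \<box> G)" for x y
  proof -
    have "visible (G \<box> H) X (prod.swap x) (prod.swap y)"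
      using assms xy unfolding total_mutual_visibility_set_def by auto
    then obtain p where p: "shortest_path (G \<box> H) (prod.swap x) p (prod.swap y)"
        "set p \<inter> X \<subseteq> {prod.swap x, prod.swap y}"
      unfolding visible_def by blast
    have "set (map prod.swap p) \<inter> prod.swap ` X = prod.swap ` (set p \<inter> X)"
      by auto
    also have "\<dots> \<subseteq> {x, y}"
      using image_mono[OF p(2), of prod.swap] by simp
    finally show ?thesis
      using shortest_path_swap[OF p(1)] unfolding visible_def swap_swap by blast
  qed
  then show ?thesis
    using assms unfolding total_mutual_visibility_set_def by auto
qed

section \<open>Bounding the total mutual-visibility number\<close>

lemma finite_total_mutual_visibility_cards:
  assumes "finite S" "\<And>X. total_mutual_visibility_set G X \<Longrightarrow> X \<subseteq> S"
  shows "finite {card X | X. total_mutual_visibility_set G X}"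
proof -
  have "{card X | X. total_mutual_visibility_set G X} \<subseteq> card ` Pow S"
    using assms(2) by auto
  then show ?thesis
    using assms(1) by (meson finite_Pow_iff finite_imageI finite_subset)
qed

lemma mu_t_eqI:
  assumes "finite S" "\<And>X. total_mutual_visibility_set G X \<Longrightarrow> X \<subseteq> S"
    and "total_mutual_visibility_set G S"
  shows "mu_t G = card S"
  unfolding mu_t_def
proof (rule Max_eqI[OF finite_total_mutual_visibility_cards])
  show "n \<le> card S" if "n \<in> {card X | X. total_mutual_visibility_set G X}" for n
    using that assms(1,2) by (auto intro: card_mono)
qed (use assms in auto)

text \<open>The set \<open>X0\<close> makes the family of cardinalities nonempty, so the maximum is
  attained by some \<open>X\<close>; proper inclusion in the finite set \<open>S\<close> then gives
  strictness.\<close>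

lemma mu_t_less:
  assumes "finite S" "\<And>X. total_mutual_visibility_set G X \<Longrightarrow> X \<subset> S"
    and "total_mutual_visibility_set G X0"
  shows "mu_t G < card S"
proof -
  have "mu_t G \<in> {card X | X. total_mutual_visibility_set G X}"
    unfolding mu_t_def
    using finite_total_mutual_visibility_cards[OF assms(1), of G] assms(2,3)
    by (intro Max_in) auto
  then obtain X where "mu_t G = card X" "X \<subset> S"
    using assms(2) by blast
  then show ?thesis
    using psubset_card_mono[OF assms(1)] by simp
qed

section \<open>Graphs with a separating universal vertex\<close>

text \<open>Isolates two features of a non-trivial generalized complete graph: a universal vertex
  \<open>c\<close>, and a nonadjacent pair with no common neighbour other than \<open>c\<close>, as
  given by vertices of two different cliques.\<close>

locale apex_graph = pair_graph G for G :: "'a pair_pre_digraph" +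
  fixes c :: 'a
  assumes apex_in: "c \<in> pverts G"
    and apex_adj: "v \<in> pverts G \<Longrightarrow> v \<noteq> c \<Longrightarrow> (c, v) \<in> parcs G"
    and separated: "\<exists>u v. u \<in> pverts G \<and> v \<in> pverts G \<and> u \<noteq> v \<and> (u, v) \<notin> parcs G \<and>
      (\<forall>w. (u, w) \<in> parcs G \<longrightarrow> (w, v) \<in> parcs G \<longrightarrow> w = c)"
begin

lemma wf_arcs: "(u, v) \<in> parcs G \<Longrightarrow> u \<in> pverts G \<and> v \<in> pverts G \<and> u \<noteq> v"
  using in_arcsD1 in_arcsD2 no_loops' by blast

lemma apex_adj': "v \<in> pverts G \<Longrightarrow> v \<noteq> c \<Longrightarrow> (v, c) \<in> parcs G"
  using apex_adj arcs_symmetric by blast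

text \<open>Any two vertices are equal, adjacent or joined through \<open>c\<close>, so the lower
  bound \<open>dist2\<close> is attained by a walk with no inner vertex other than
  \<open>c\<close>.\<close>

lemma walk_in_dist2:
  assumes "u \<in> pverts G" "v \<in> pverts G"
  shows "walk_in G {u, v, c} (dist2 G u v) u v"
proof -
  let ?p = "if u = v then [u] else if (u, v) \<in> parcs G then [u, v] else [u, c, v]"
  have "u = c \<or> v = c \<Longrightarrow> u = v \<or> (u, v) \<in> parcs G"
    using assms apex_adj apex_adj' by blast
  then have "vwalk ?p (with_proj G)"
    using assms apex_in apex_adj apex_adj' by (auto simp: vwalk_def)
  then show ?thesis
    unfolding walk_in_def dist2_def by (intro exI[of _ ?p]) auto
qed

lemma total_mutual_visibility_set_verts_minus_apex:
  "total_mutual_visibility_set G (pverts G - {c})"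
  unfolding total_mutual_visibility_set_def
proof (intro conjI ballI)
  fix x y assume xy: "x \<in> pverts G" "y \<in> pverts G"
  show "visible G (pverts G - {c}) x y"
  proof (rule visibleI[OF walk_in_dist2[OF xy]])
    show "dist2 G x y \<le> vwalk_length q"
      if "vwalk q (with_proj G)" "hd q = x" "last q = y" for q
      using dist2_le_vwalk_length[OF that(1)] that(2,3) by simp
  qed blast
qed auto

lemma apex_notin:
  assumes "total_mutual_visibility_set G X"
  shows "c \<notin> X"
proof -
  obtain u v where uv: "u \<in> pverts G" "v \<in> pverts G" "u \<noteq> v" "(u, v) \<notin> parcs G"
    and uniq: "\<And>w. (u, w) \<in> parcs G \<Longrightarrow> (w, v) \<in> parcs G \<Longrightarrow> w = c"
    using separated by blast
  have "u \<noteq> c" "v \<noteq> c"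
    using uv apex_adj apex_adj' by blast+
  moreover have "visible G X u v"
    using assms uv unfolding total_mutual_visibility_set_def by blast
  ultimately obtain z where "(u, z) \<in> parcs G" "(z, v) \<in> parcs G" "z \<notin> X"
    using visible_common_neighbour[of G X u v c] uv apex_adj apex_adj' wf_arcs by metis
  with uniq show ?thesis by blast
qed

lemma mu_t_eq: "mu_t G = card (pverts G) - 1"
proof -
  have "mu_t G = card (pverts G - {c})"
  proof (rule mu_t_eqI)
    show "X \<subseteq> pverts G - {c}" if "total_mutual_visibility_set G X" for X
      using that apex_notin[OF that] unfolding total_mutual_visibility_set_def by blast
  qed (simp_all add: total_mutual_visibility_set_verts_minus_apex pair_finite_verts)
  then show ?thesis using apex_in by simp
qed

lemma star_iff: "star G \<longleftrightarrow> (\<forall>(u, v) \<in> parcs G. u = c \<or> v = c)"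
proof
  assume "star G"
  then obtain U V where UV: "U \<inter> V = {}" "parcs G = U \<times> V \<union> V \<times> U"
    unfolding star_def complete_bipartite_digraph_pair_def by blast
  show "\<forall>(u, v) \<in> parcs G. u = c \<or> v = c"
  proof (clarify, rule ccontr)
    fix u v assume uv: "(u, v) \<in> parcs G" "v \<noteq> c" "u \<noteq> c"
    \<comment> \<open>Together with \<open>(u, v)\<close> these arcs form a triangle, which a
      bipartite graph does not contain.\<close>
    then have "(c, u) \<in> parcs G" "(c, v) \<in> parcs G"
      using apex_adj wf_arcs by blast+
    with uv UV show False by auto
  qed
next
  assume *: "\<forall>(u, v) \<in> parcs G. u = c \<or> v = c"
  let ?V = "pverts G - {c}"
  have "parcs G = {c} \<times> ?V \<union> ?V \<times> {c}"
  proof (rule set_eqI, clarify)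
    fix u v
    show "(u, v) \<in> parcs G \<longleftrightarrow> (u, v) \<in> {c} \<times> ?V \<union> ?V \<times> {c}"
      using * apex_adj[of v] apex_adj'[of u] wf_arcs[of u v] by auto
  qed
  moreover have "pverts G = {c} \<union> ?V"
    using apex_in by blast
  moreover have "{c} \<inter> ?V = {}" "card {c} = 1"
    by simp_all
  ultimately have "\<exists>V. pverts G = {c} \<union> V \<and> {c} \<inter> V = {} \<and> card {c} = 1
      \<and> card V = card ?V \<and> parcs G = {c} \<times> V \<union> V \<times> {c}"
    by (intro exI[of _ ?V] conjI refl)
  then have "K\<^bsub>1,card ?V\<^esub> (with_proj G)"
    unfolding complete_bipartite_digraph_pair_def
    by (intro conjI[OF pair_finite_verts exI[of _ "{c}"]])
  then show "star G" unfolding star_def by blast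
qed

end

lemma nontrivial_generalized_complete_graph_apex:
  assumes "nontrivial_generalized_complete_graph G"
  obtains c where "apex_graph G c"
proof -
  from assms obtain k where k: "k \<ge> 2" "generalized_complete_graph k G"
    unfolding nontrivial_generalized_complete_graph_def by blast
  interpret pair_graph G
    using k(2) by (rule pair_graph_generalized_complete_graph)
  from k(2) obtain c Q where
    K: "\<And>i. i < k \<Longrightarrow> \<exists>n\<ge>1. K\<^bsub>n\<^esub> (with_proj (Q i))" and
    disj: "disjoint_family_on (\<lambda>i. pverts (Q i)) {..<k}" and
    c: "\<And>i. i < k \<Longrightarrow> c \<notin> pverts (Q i)" and
    G: "G = graph_join (single_vertex c) (graph_Union {..<k} Q)"
    unfolding generalized_complete_graph_def by blast
  have verts: "pverts G = insert c (\<Union>i<k. pverts (Q i))"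
    unfolding G graph_join_def single_vertex_def graph_Union_def by simp
  have arcs: "parcs G = (\<Union>i<k. parcs (Q i)) \<union> {c} \<times> (\<Union>i<k. pverts (Q i))
      \<union> (\<Union>i<k. pverts (Q i)) \<times> {c}"
    unfolding G graph_join_def single_vertex_def graph_Union_def by simp
  have Q: "parcs (Q i) \<subseteq> pverts (Q i) \<times> pverts (Q i)" "pverts (Q i) \<noteq> {}" if "i < k" for i
    using K[OF that] by (auto simp: complete_digraph_pair_def)
  have same_part: "i = j" if "u \<in> pverts (Q i)" "u \<in> pverts (Q j)" "i < k" "j < k" for u i j
    using disj that unfolding disjoint_family_on_def by blast
  \<comment> \<open>An arc can leave a clique only towards \<open>c\<close>.\<close>
  have part: "v \<in> pverts (Q i)"
    if "(u, v) \<in> parcs G" "u \<in> pverts (Q i)" "i < k" "v \<noteq> c" for u v i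
  proof -
    have "u \<noteq> c" using c that by blast
    with that(1,4) obtain j where j: "j < k" "(u, v) \<in> parcs (Q j)"
      unfolding arcs by auto
    with Q(1) have "u \<in> pverts (Q j)" "v \<in> pverts (Q j)" by blast+
    with same_part that j show ?thesis by blast
  qed
  \<comment> \<open>Since \<open>k \<ge> 2\<close> and the cliques are nonempty, two different
    cliques supply the separated pair.\<close>
  obtain u v where uv: "u \<in> pverts (Q 0)" "v \<in> pverts (Q 1)"
    using Q(2)[of 0] Q(2)[of 1] k(1) by fastforce
  have v: "v \<notin> pverts (Q 0)" "v \<noteq> c"
    using uv same_part[of v 0 1] c[of 1] k(1) by auto
  have "apex_graph G c"
  proof unfold_locales
    show "\<exists>u v. u \<in> pverts G \<and> v \<in> pverts G \<and> u \<noteq> v \<and> (u, v) \<notin> parcs G \<and>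
      (\<forall>w. (u, w) \<in> parcs G \<longrightarrow> (w, v) \<in> parcs G \<longrightarrow> w = c)"
    proof (intro exI conjI allI impI)
      show "u \<in> pverts G" "v \<in> pverts G"
        using uv k(1) unfolding verts by force+
      show "u \<noteq> v" using uv v by blast
      show "(u, v) \<notin> parcs G" using part[of u v 0] uv v k(1) by auto
      \<comment> \<open>A common neighbour other than \<open>c\<close> would lie in
        \<open>Q 0\<close> like \<open>u\<close>, and would then force \<open>v\<close> into
        \<open>Q 0\<close> as well.\<close>
      show "w = c" if "(u, w) \<in> parcs G" "(w, v) \<in> parcs G" for w
        using part[of u w 0] part[of w v 0] that uv v k(1) by auto
    qed
  qed (auto simp: verts arcs)
  then show thesis by (rule that)
qed

section \<open>Products of graphs with separating universal vertices\<close>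

lemma product_wf_arcs:
  assumes "apex_graph G c" "apex_graph H d" "(x, y) \<in> parcs (G \<box> H)"
  shows "x \<in> pverts (G \<box> H) \<and> y \<in> pverts (G \<box> H) \<and> x \<noteq> y"
  using assms(3) apex_graph.wf_arcs[OF assms(1)] apex_graph.wf_arcs[OF assms(2)]
  by (auto simp: cartesian_product_def)

lemma total_mutual_visibility_set_product_apex:
  assumes "apex_graph G c" "apex_graph H d"
    and X: "total_mutual_visibility_set (G \<box> H) X"
  shows "(c, h) \<notin> X"
proof
  assume ch: "(c, h) \<in> X"
  interpret G: apex_graph G c by fact
  have h: "h \<in> pverts H"
    using ch X unfolding total_mutual_visibility_set_def by auto
  obtain u v where uv: "u \<in> pverts G" "v \<in> pverts G" "u \<noteq> v" "(u, v) \<notin> parcs G"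
    and uniq: "\<And>w. (u, w) \<in> parcs G \<Longrightarrow> (w, v) \<in> parcs G \<Longrightarrow> w = c"
    using G.separated by blast
  have uvc: "u \<noteq> c" "v \<noteq> c"
    using uv G.apex_adj G.apex_adj' by blast+
  have vis: "visible (G \<box> H) X (u, h) (v, h)"
    using X uv h unfolding total_mutual_visibility_set_def by simp
  have "((u, h), (v, h)) \<notin> parcs (G \<box> H)" "((u, h), (c, h)) \<in> parcs (G \<box> H)"
    "((c, h), (v, h)) \<in> parcs (G \<box> H)"
    using uv uvc h G.apex_in G.apex_adj G.apex_adj' by (auto simp: cartesian_product_def)
  then obtain z where z: "((u, h), z) \<in> parcs (G \<box> H)" "(z, (v, h)) \<in> parcs (G \<box> H)" "z \<notin> X"
    using visible_common_neighbour[OF vis] product_wf_arcs[OF assms(1,2)] uv(3) by (metis prod.inject)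
  \<comment> \<open>If one of the two arcs changed the second coordinate, the other alone would have
    to lead from \<open>u\<close> to \<open>v\<close>, which are distinct and nonadjacent. So
    \<open>z\<close> lies in the layer of \<open>h\<close>.\<close>
  then have "z = (c, h)"
    using uniq uv(3,4) by (auto simp: cartesian_product_def)
  with z(3) ch show False by simp
qed

lemma total_mutual_visibility_set_product_subset:
  assumes "apex_graph G c" "apex_graph H d"
    and X: "total_mutual_visibility_set (G \<box> H) X"
  shows "X \<subseteq> (pverts G - {c}) \<times> (pverts H - {d})"
proof -
  have "(c, h) \<notin> X" for h
    by (rule total_mutual_visibility_set_product_apex[OF assms])
  moreover have "(d, g) \<notin> prod.swap ` X" for g
    by (rule total_mutual_visibility_set_product_apex
        [OF assms(2,1) total_mutual_visibility_set_swap[OF X]])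
  ultimately show ?thesis
    using X unfolding total_mutual_visibility_set_def by force
qed

text \<open>Moving first in \<open>G\<close> and then in \<open>H\<close> attains the lower bound on
  the distance. This provides the member needed for the maximum defining \<open>mu_t\<close> to be
  taken over a nonempty set.\<close>

lemma total_mutual_visibility_set_product_empty:
  assumes "apex_graph G c" "apex_graph H d"
  shows "total_mutual_visibility_set (G \<box> H) {}"
  unfolding total_mutual_visibility_set_def
proof (intro conjI ballI)
  fix x y assume "x \<in> pverts (G \<box> H)" "y \<in> pverts (G \<box> H)"
  then obtain g h g' h' where xy: "x = (g, h)" "y = (g', h')"
    and in_verts: "g \<in> pverts G" "h \<in> pverts H" "g' \<in> pverts G" "h' \<in> pverts H" by auto
  note walk_in_trans[OF
      walk_in_product_left[OF apex_graph.walk_in_dist2[OF assms(1) in_verts(1,3)] in_verts(2)]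
      walk_in_product_right[OF apex_graph.walk_in_dist2[OF assms(2) in_verts(2,4)] in_verts(3)]]
  from visible_productI[OF this] show "visible (G \<box> H) {} x y" by (simp add: xy)
qed auto

lemma total_mutual_visibility_set_product_star:
  assumes "apex_graph G c" "apex_graph H d" "star G"
  shows "total_mutual_visibility_set (G \<box> H) ((pverts G - {c}) \<times> (pverts H - {d}))"
    (is "total_mutual_visibility_set _ ?X")
  unfolding total_mutual_visibility_set_def
proof (intro conjI ballI)
  interpret G: apex_graph G c by fact
  interpret H: apex_graph H d by fact
  fix x y assume "x \<in> pverts (G \<box> H)" "y \<in> pverts (G \<box> H)"
  then obtain g h g' h' where xy: "x = (g, h)" "y = (g', h')"
    and in_verts: "g \<in> pverts G" "h \<in> pverts H" "g' \<in> pverts G" "h' \<in> pverts H" by auto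
  show "visible (G \<box> H) ?X x y"
  proof (cases "g = g'")
    case True
    \<comment> \<open>Within a single \<open>H\<close>-layer the only possible inner vertex is
      \<open>(g, d)\<close>, which lies outside the set.\<close>
    have "walk_in (G \<box> H) ({g} \<times> {h, h', d}) (dist2 G g g' + dist2 H h h') (g, h) (g', h')"
      using walk_in_product_right[OF H.walk_in_dist2[OF in_verts(2,4)] in_verts(1)] True
      by (simp add: dist2_def)
    then show ?thesis
      unfolding xy by (rule visible_productI) (use True in auto)
  next
    case False
    \<comment> \<open>The detour through \<open>c\<close> costs nothing: in a star, distinct
      vertices other than \<open>c\<close> are nonadjacent, hence at distance 2 through
      \<open>c\<close>. The second coordinate can thus be changed inside the layer of
      \<open>c\<close>, and only the endpoints can meet the set.\<close>
    have "dist2 G g c + dist2 H h h' + dist2 G c g' = dist2 G g g' + dist2 H h h'"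
    proof (cases "g = c \<or> g' = c")
      case True
      then show ?thesis by (auto simp: dist2_def)
    next
      case outer: False
      then have "(g, g') \<notin> parcs G"
        using assms(3) unfolding G.star_iff by blast
      then show ?thesis
        using outer False G.apex_adj[OF in_verts(3)] G.apex_adj'[OF in_verts(1)]
        by (auto simp: dist2_def)
    qed
    moreover note walk_in_trans[OF walk_in_trans[OF
        walk_in_product_left[OF G.walk_in_dist2[OF in_verts(1) G.apex_in] in_verts(2)]
        walk_in_product_right[OF H.walk_in_dist2[OF in_verts(2,4)] G.apex_in]]
        walk_in_product_left[OF G.walk_in_dist2[OF G.apex_in in_verts(3)] in_verts(4)]]
    ultimately have "walk_in (G \<box> H)
        ({g, c, c} \<times> {h} \<union> {c} \<times> {h, h', d} \<union> {c, g', c} \<times> {h'})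
        (dist2 G g g' + dist2 H h h') (g, h) (g', h')"
      by (simp only:)
    then show ?thesis
      unfolding xy by (rule visible_productI) auto
  qed
qed auto

lemma not_total_mutual_visibility_set_product:
  assumes "apex_graph G c" "apex_graph H d" "\<not> star G" "\<not> star H"
  shows "\<not> total_mutual_visibility_set (G \<box> H) ((pverts G - {c}) \<times> (pverts H - {d}))"
    (is "\<not> total_mutual_visibility_set _ ?X")
proof
  assume X: "total_mutual_visibility_set (G \<box> H) ?X"
  interpret G: apex_graph G c by fact
  interpret H: apex_graph H d by fact
  obtain g g' where g: "(g, g') \<in> parcs G" "g \<noteq> c" "g' \<noteq> c"
    using assms(3) unfolding G.star_iff by auto
  obtain h h' where h: "(h, h') \<in> parcs H" "h \<noteq> d" "h' \<noteq> d"
    using assms(4) unfolding H.star_iff by auto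
  note gh = G.wf_arcs[OF g(1)] H.wf_arcs[OF h(1)]
  have vis: "visible (G \<box> H) ?X (g, h) (g', h')"
    using X gh unfolding total_mutual_visibility_set_def by simp
  have "((g, h), (g', h')) \<notin> parcs (G \<box> H)" "((g, h), (g', h)) \<in> parcs (G \<box> H)"
    "((g', h), (g', h')) \<in> parcs (G \<box> H)"
    using g h gh by (auto simp: cartesian_product_def)
  then obtain z where z: "((g, h), z) \<in> parcs (G \<box> H)" "(z, (g', h')) \<in> parcs (G \<box> H)" "z \<notin> ?X"
    using visible_common_neighbour[OF vis] product_wf_arcs[OF assms(1,2)] gh by (metis prod.inject)
  \<comment> \<open>Opposite corners of the 4-cycle have only the other two corners as common
    neighbours, and both belong to the set.\<close>
  then have "z = (g, h') \<or> z = (g', h)"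
    using gh by (auto simp: cartesian_product_def)
  with z(3) g h gh show False by auto
qed

theorem theorem5p1:
  fixes G :: "'a pair_pre_digraph" and H :: "'b pair_pre_digraph"
  assumes "nontrivial_generalized_complete_graph G"
    and "nontrivial_generalized_complete_graph H"
  shows "mu_t (G \<box> H) \<le> mu_t G * mu_t H
    \<and> mu_t G * mu_t H = (card (pverts G) - 1) * (card (pverts H) - 1)
    \<and> (mu_t (G \<box> H) = (card (pverts G) - 1) * (card (pverts H) - 1) \<longleftrightarrow> star G \<or> star H)"
proof -
  obtain c where c: "apex_graph G c"
    using nontrivial_generalized_complete_graph_apex[OF assms(1)] .
  obtain d where d: "apex_graph H d"
    using nontrivial_generalized_complete_graph_apex[OF assms(2)] .
  interpret G: apex_graph G c by fact
  interpret H: apex_graph H d by fact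
  let ?S = "(pverts G - {c}) \<times> (pverts H - {d})"
  have fin: "finite ?S"
    using G.pair_finite_verts H.pair_finite_verts by simp
  have card: "card ?S = (card (pverts G) - 1) * (card (pverts H) - 1)"
    using G.apex_in H.apex_in by (simp add: card_cartesian_product)
  note sub = total_mutual_visibility_set_product_subset[OF c d]
  have "mu_t (G \<box> H) = card ?S" if "star G \<or> star H"
  proof (rule mu_t_eqI[OF fin sub])
    \<comment> \<open>If \<open>H\<close> is the star, the construction is made in
      \<open>H \<box> G\<close> and swapped back.\<close>
    have "prod.swap ` ((pverts H - {d}) \<times> (pverts G - {c})) = ?S"
      by (rule product_swap)
    then show "total_mutual_visibility_set (G \<box> H) ?S"
      using that total_mutual_visibility_set_product_star[OF c d]
        total_mutual_visibility_set_swap[OF total_mutual_visibility_set_product_star[OF d c]]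
      by auto
  qed
  moreover have "mu_t (G \<box> H) < card ?S" if "\<not> (star G \<or> star H)"
  proof (rule mu_t_less[OF fin _ total_mutual_visibility_set_product_empty[OF c d]])
    \<comment> \<open>Inclusion always holds, and equality is excluded because \<open>?S\<close>
      itself fails when neither factor is a star.\<close>
    show "X \<subset> ?S" if X: "total_mutual_visibility_set (G \<box> H) X" for X
      using sub[OF X] X not_total_mutual_visibility_set_product[OF c d]
        \<open>\<not> (star G \<or> star H)\<close> by blast
  qed
  ultimately show ?thesis
    unfolding G.mu_t_eq H.mu_t_eq card by linarith
qed

end
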